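(* Let $A,H,K$ be three logically independent events, with $H\neq\emptyset$, $K\neq\emptyset$. The set $\Pi$ of all coherent assessments $(x,y,z)$ on the family $\mathcal F=\{A|H,\ A|K,\ (A|H)\wedge(A|K)\}$ is given by $$\Pi=\{(x,y,z):\ (x,y)\in[0,1]^2,\ xy\le z\le\min\{x,y\}\}.$$
   Context: **Events.** Events are subsets of a set $\Omega$ of elementary outcomes; $\overline{E}$ is the complement of $E$, juxtaposition $EF$ denotes intersection, $\vee$ denotes union, and an event is true at an outcome belonging to it. Events $E_1,\dots,E_n$ are logically independent if all $2^n$ intersections $E_1^*\cdots E_n^*$, with $E_i^*\in\{E_i,\overline{E}_i\}$, are nonempty. **Conditional events.** For $H\neq\emptyset$ and an assessed probability $P(A|H)=x$, the conditional event $A|H$ is identified with the random quantity equal to $1$ on $AH$, $0$ on $\overline{A}H$, and $x$ on $\overline{H}$. It is a conditional random quantity with conditioning event $H$ and prevision $x$. **Conjunction.** Given $P(A|H)=x$, $P(A|K)=y$, the conjunction $(A|H)\wedge(A|K)$, with prevision $z=\mathbb{P}[(A|H)\wedge(A|K)]$, is the random quantity equal to: $1$ on $AHK$; $0$ on $\overline{A}H\vee\overline{A}K$; $x$ on $\overline{H}AK$; $y$ on $AH\overline{K}$; $z$ on $\overline{H}\,\overline{K}$. It is a conditional random quantity with conditioning event $H\vee K$ and prevision $z$. **Coherence.** Let $\mathcal F=\{X_1|H_1,\dots,X_n|H_n\}$ be a finite family of conditional random quantities, where $X_i$ takes finitely many real values when the conditioning event $H_i\ne\emptyset$ is true, and let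 $\mathcal M=(\mu_1,\dots,\mu_n)\in\mathbb R^n$ be a (prevision) assessment, $\mu_i=\mathbb P(X_i|H_i)$. Let $C_1,\dots,C_m$ be the constituents contained in $H_1\vee\cdots\vee H_n$, i.e. the nonempty atoms of the finite partition generated by the events $H_i$ and the events $(X_i=\text{value})\cap H_i$. To $C_h$ associate $Q_h=(q_{h1},\dots,q_{hn})$, where $q_{hi}$ is the value of $X_i$ on $C_h$ if $C_h\subseteq H_i$, and $q_{hi}=\mu_i$ if $C_h\subseteq\overline{H}_i$. Let $S$ be the set of vectors $(\lambda_1,\dots,\lambda_m)$ with $\lambda_h\ge 0$, $\sum_h\lambda_h=1$, $\sum_h\lambda_hQ_h=\mathcal M$, and, when $S\neq\emptyset$, let $I_0=\{i:\max_{\Lambda\in S}\sum_{h:C_h\subseteq H_i}\lambda_h=0\}$. Then $\mathcal M$ is coherent on $\mathcal F$ if and only if (i) $S\neq\emptyset$, and (ii) if $I_0\ne\emptyset$, then the sub-assessment $(\mu_i,\ i\in I_0)$ on $\{X_i|H_i,\ i\in I_0\}$ is coherent (the recursion terminates because $I_0$ is a proper subset of $\{1,\dots,n\}$). *)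

theory Defs
  imports Complex_Main
begin

text \<open>Events are subsets of the set of elementary outcomes, which is the whole type \<open>'w\<close>.\<close>

text \<open>Events are indexed by their position in the list, so that repeated events count separately.\<close>

definition logically_independent :: "'w set list \<Rightarrow> bool" where
  "logically_independent Es \<longleftrightarrow>
     (\<forall>J \<subseteq> {..<length Es}.
        (\<Inter>i\<in>J. Es ! i) \<inter> (\<Inter>i\<in>{..<length Es} - J. - (Es ! i)) \<noteq> {})"

text \<open>A conditional random quantity \<open>X|H\<close> is a pair \<open>(X, H)\<close>. Coherence below only looks at the
  values of \<open>X\<close> on \<open>H\<close>.\<close>

type_synonym 'w cond_rq = "('w \<Rightarrow> real) \<times> 'w set"

abbreviation quantity :: "'w cond_rq \<Rightarrow> 'w \<Rightarrow> real" where
  "quantity \<equiv> fst"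

abbreviation conditioning :: "'w cond_rq \<Rightarrow> 'w set" where
  "conditioning \<equiv> snd"

text \<open>\<open>A|H\<close> with assessed probability \<open>x\<close>.\<close>

definition cond_event :: "'w set \<Rightarrow> 'w set \<Rightarrow> real \<Rightarrow> 'w cond_rq" where
  "cond_event A H x =
     (\<lambda>w. if w \<in> A \<inter> H then 1
          else if w \<in> - A \<inter> H then 0
          else x,
      H)"

text \<open>\<open>(A|H) \<and> (A|K)\<close> with prevision \<open>z\<close>, where \<open>P(A|H) = x\<close> and \<open>P(A|K) = y\<close>. The last case is
  \<open>w \<in> - H \<inter> - K\<close>.\<close>

definition conj_cond_event ::
  "'w set \<Rightarrow> 'w set \<Rightarrow> 'w set \<Rightarrow> real \<Rightarrow> real \<Rightarrow> real \<Rightarrow> 'w cond_rq" where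
  "conj_cond_event A H K x y z =
     (\<lambda>w. if w \<in> A \<inter> H \<inter> K then 1
          else if w \<in> (- A \<inter> H) \<union> (- A \<inter> K) then 0
          else if w \<in> - H \<inter> A \<inter> K then x
          else if w \<in> A \<inter> H \<inter> - K then y
          else z,
      H \<union> K)"

definition atoms :: "'w set set \<Rightarrow> 'w set set" where
  "atoms G = {C. C \<noteq> {} \<and> (\<exists>G' \<subseteq> G. C = \<Inter> G' \<inter> (\<Inter>E\<in>G - G'. - E))}"

definition generating_events :: "('i \<Rightarrow> 'w cond_rq) \<Rightarrow> 'i set \<Rightarrow> 'w set set" where
  "generating_events F I =
     (\<Union>i\<in>I. insert (conditioning (F i))
        {{w \<in> conditioning (F i). quantity (F i) w = v} | v.
           v \<in> quantity (F i) ` conditioning (F i)})"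

definition constituents :: "('i \<Rightarrow> 'w cond_rq) \<Rightarrow> 'i set \<Rightarrow> 'w set set" where
  "constituents F I =
     {C \<in> atoms (generating_events F I). C \<subseteq> (\<Union>i\<in>I. conditioning (F i))}"

text \<open>The coordinate \<open>q\<^sub>h\<^sub>i\<close>; on a constituent \<open>C \<subseteq> H\<^sub>i\<close> the quantity \<open>X\<^sub>i\<close> is constant.\<close>

definition point :: "('i \<Rightarrow> 'w cond_rq) \<Rightarrow> ('i \<Rightarrow> real) \<Rightarrow> 'w set \<Rightarrow> 'i \<Rightarrow> real" where
  "point F \<mu> C i =
     (if C \<subseteq> conditioning (F i) then the_elem (quantity (F i) ` C) else \<mu> i)"

text \<open>The vectors \<open>\<Lambda>\<close> are indexed by the constituents; their values elsewhere are irrelevant.\<close>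

definition solutions ::
  "('i \<Rightarrow> 'w cond_rq) \<Rightarrow> ('i \<Rightarrow> real) \<Rightarrow> 'i set \<Rightarrow> ('w set \<Rightarrow> real) set" where
  "solutions F \<mu> I =
     {\<Lambda>. (\<forall>C\<in>constituents F I. \<Lambda> C \<ge> 0)
        \<and> (\<Sum>C\<in>constituents F I. \<Lambda> C) = 1
        \<and> (\<forall>i\<in>I. (\<Sum>C\<in>constituents F I. \<Lambda> C * point F \<mu> C i) = \<mu> i)}"

text \<open>For a finite family of finitely-valued quantities with \<open>solutions F \<mu> I \<noteq> {}\<close>, the supremum
  is attained, the solutions forming a compact polytope in the relevant coordinates.\<close>

definition null_indices :: "('i \<Rightarrow> 'w cond_rq) \<Rightarrow> ('i \<Rightarrow> real) \<Rightarrow> 'i set \<Rightarrow> 'i set" where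
  "null_indices F \<mu> I =
     {i \<in> I. (SUP \<Lambda>\<in>solutions F \<mu> I.
               \<Sum>C | C \<in> constituents F I \<and> C \<subseteq> conditioning (F i). \<Lambda> C) = 0}"

text \<open>The least fixed point is the only one on finite families, since \<open>null_indices F \<mu> I\<close> is then a
  proper subset of \<open>I\<close> (lemma \<open>null_indices_psubset\<close>).\<close>

inductive coherent_on :: "('i \<Rightarrow> 'w cond_rq) \<Rightarrow> ('i \<Rightarrow> real) \<Rightarrow> 'i set \<Rightarrow> bool"
  for F :: "'i \<Rightarrow> 'w cond_rq" and \<mu> :: "'i \<Rightarrow> real" where
  "coherent_on F \<mu> I"
    if "solutions F \<mu> I \<noteq> {}"
      and "null_indices F \<mu> I \<noteq> {} \<longrightarrow> coherent_on F \<mu> (null_indices F \<mu> I)"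

lemma null_indices_psubset:
  assumes "solutions F \<mu> I \<noteq> {}"
  shows "null_indices F \<mu> I \<subset> I"
proof -
  let ?C = "constituents F I"
  obtain L where L: "L \<in> solutions F \<mu> I"
    using assms by blast
  have nonneg: "M C \<ge> 0" if "M \<in> solutions F \<mu> I" "C \<in> ?C" for M C
    using that by (auto simp: solutions_def)
  have one: "sum M ?C = 1" if "M \<in> solutions F \<mu> I" for M
    using that by (auto simp: solutions_def)
  have fin: "finite ?C"
    using one[OF L] by (metis sum.infinite zero_neq_one)
  have "\<exists>C\<in>?C. L C > 0"
  proof (rule ccontr)
    assume "\<not> ?thesis"
    then have "sum L ?C \<le> 0"
      by (intro sum_nonpos) force
    then show False
      using one[OF L] by simp
  qed
  then obtain C where C: "C \<in> ?C" "L C > 0"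
    by blast
  obtain w where w: "w \<in> C"
    using C(1) by (auto simp: constituents_def atoms_def)
  then obtain i where i: "i \<in> I" "w \<in> conditioning (F i)"
    using C(1) by (auto simp: constituents_def)
  have gen: "conditioning (F i) \<in> generating_events F I"
    using i(1) by (auto simp: generating_events_def)
  obtain G' where G': "C = \<Inter> G' \<inter> (\<Inter>E\<in>generating_events F I - G'. - E)"
    using C(1) by (auto simp: constituents_def atoms_def)
  have "conditioning (F i) \<in> G'"
    using G' gen w i(2) by (metis ComplD DiffI INT_E IntD2)
  then have sub: "C \<subseteq> conditioning (F i)"
    unfolding G' by (meson Inf_lower le_infI1)
  let ?D = "{C. C \<in> ?C \<and> C \<subseteq> conditioning (F i)}"
  have "L C \<le> sum L ?D"
    by (rule member_le_sum) (use C sub fin nonneg[OF L] in auto)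
  also have "\<dots> \<le> (SUP M\<in>solutions F \<mu> I. sum M ?D)"
  proof (rule cSUP_upper[OF L], rule bdd_aboveI2)
    fix M assume M: "M \<in> solutions F \<mu> I"
    have "sum M ?D \<le> sum M ?C"
      by (rule sum_mono2) (use fin nonneg[OF M] in auto)
    then show "sum M ?D \<le> 1"
      using one[OF M] by simp
  qed
  finally have "i \<notin> null_indices F \<mu> I"
    using C(2) by (simp add: null_indices_def)
  then show ?thesis
    using i(1) by (auto simp: null_indices_def)
qed

definition coherent_assessment :: "'w cond_rq list \<Rightarrow> real list \<Rightarrow> bool" where
  "coherent_assessment Fs Ms \<longleftrightarrow>
     length Fs = length Ms \<and> coherent_on ((!) Fs) ((!) Ms) {..<length Fs}"

end

theory Submission
  imports Defs
begin

text \<open>Write \<open>q\<^sub>1, q\<^sub>2, q\<^sub>3\<close> for the three random quantities. A solution \<open>\<Lambda>\<close> is a probability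
  under which each \<open>q\<^sub>i\<close> has expectation \<open>\<mu>\<^sub>i\<close>, so pointwise linear inequalities between the \<open>q\<^sub>i\<close> pass
  to the assessment. For \<open>x, y \<in> [0, 1]\<close> one has pointwise \<open>q\<^sub>3 \<le> q\<^sub>1\<close>, \<open>q\<^sub>3 \<le> q\<^sub>2\<close> and
  \<open>q\<^sub>3 - y q\<^sub>1 - x q\<^sub>2 + x y \<ge> 0\<close> (the left side is \<open>(1 - x) (1 - y)\<close> on \<open>AHK\<close>, \<open>x y\<close> on
  \<open>\<not>A HK\<close>, and \<open>0\<close> on the other constituents), which gives the bounds on \<open>z\<close>; that
  \<open>x, y \<in> [0, 1]\<close> follows along the recursion. Conversely, a weight on six outcomes,
  one per constituent, solves the system while charging both \<open>H\<close> and \<open>K\<close>, so the recursion stops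
  at once. For \<open>x \<le> y\<close> this weight is a mixture of a solution for \<open>z = x y\<close> (charging only
  \<open>H \<inter> -K\<close> and \<open>-H \<inter> K\<close>) and one for \<open>z = x\<close> (charging only \<open>H\<close>).\<close>

section \<open>Passing between outcomes and constituents\<close>

text \<open>An outcome-wise counterpart of \<open>point\<close>, with the same default
  \<open>\<mu> i\<close> off the conditioning event; it lets later arguments compute on outcomes
  without enumerating constituents.\<close>

definition value_at :: "('i \<Rightarrow> 'w cond_rq) \<Rightarrow> ('i \<Rightarrow> real) \<Rightarrow> 'i \<Rightarrow> 'w \<Rightarrow> real" where
  "value_at F \<mu> i w = (if w \<in> conditioning (F i) then quantity (F i) w else \<mu> i)"

definition cell :: "'w set set \<Rightarrow> 'w \<Rightarrow> 'w set" where
  "cell G w = {v. \<forall>E\<in>G. v \<in> E \<longleftrightarrow> w \<in> E}"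

lemma atom_mem_iff:
  assumes "C \<in> atoms G" "E \<in> G" "v \<in> C" "w \<in> C"
  shows "v \<in> E \<longleftrightarrow> w \<in> E"
proof -
  obtain G' where "C = \<Inter> G' \<inter> (\<Inter>E\<in>G - G'. - E)"
    using assms(1) by (auto simp: atoms_def)
  then show ?thesis
    using assms(2-4) by (cases "E \<in> G'") auto
qed

lemma cell_in_atoms: "cell G w \<in> atoms G"
proof -
  let ?G' = "{E \<in> G. w \<in> E}"
  have "cell G w = \<Inter> ?G' \<inter> (\<Inter>E\<in>G - ?G'. - E)"
    by (auto simp: cell_def)
  moreover have "w \<in> cell G w" by (simp add: cell_def)
  moreover have "?G' \<subseteq> G" by auto
  ultimately show ?thesis unfolding atoms_def by blast
qed

lemma finite_atoms:
  assumes "finite G"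
  shows "finite (atoms G)"
proof -
  have "atoms G \<subseteq> (\<lambda>G'. \<Inter> G' \<inter> (\<Inter>E\<in>G - G'. - E)) ` Pow G"
    unfolding atoms_def by blast
  then show ?thesis using assms by (meson finite_Pow_iff finite_surj)
qed

lemma finite_constituents:
  assumes "finite I" "\<And>i. i \<in> I \<Longrightarrow> finite (quantity (F i) ` conditioning (F i))"
  shows "finite (constituents F I)"
proof -
  have "finite (generating_events F I)"
    unfolding generating_events_def
    using assms by (auto simp: setcompr_eq_image)
  then show ?thesis
    unfolding constituents_def by (auto intro: finite_subset[OF _ finite_atoms])
qed

lemma conditioning_generating:
  "i \<in> I \<Longrightarrow> conditioning (F i) \<in> generating_events F I"
  unfolding generating_events_def by blast

lemma constituent_nonempty: "C \<in> constituents F I \<Longrightarrow> C \<noteq> {}"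
  by (simp add: constituents_def atoms_def)

lemma constituent_subset_conditioning:
  assumes "C \<in> constituents F I" "i \<in> I" "w \<in> C"
  shows "C \<subseteq> conditioning (F i) \<longleftrightarrow> w \<in> conditioning (F i)"
proof -
  have "C \<in> atoms (generating_events F I)"
    using assms(1) by (simp add: constituents_def)
  from atom_mem_iff[OF this conditioning_generating[OF assms(2)] _ assms(3)]
  show ?thesis using assms(3) by (metis subset_eq)
qed

text \<open>The level set of the quantity through \<open>w\<close> is itself a generating event, so
  a constituent inside the conditioning event lies within that level set. The image under
  \<open>the_elem\<close> is therefore a singleton.\<close>

lemma point_eq_value_at:
  assumes C: "C \<in> constituents F I" and i: "i \<in> I" and w: "w \<in> C"
  shows "point F \<mu> C i = value_at F \<mu> i w"
proof (cases "C \<subseteq> conditioning (F i)")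
  case True
  let ?L = "{u \<in> conditioning (F i). quantity (F i) u = quantity (F i) w}"
  have "?L \<in> generating_events F I"
    using i w True by (auto simp: generating_events_def)
  then have "C \<subseteq> ?L"
    using atom_mem_iff[of C _ ?L _ w] C w True by (auto simp: constituents_def)
  then have "quantity (F i) ` C = {quantity (F i) w}"
    using w by blast
  then show ?thesis
    using True w by (auto simp: point_def value_at_def)
next
  case False
  then show ?thesis
    using constituent_subset_conditioning[OF C i w] by (simp add: point_def value_at_def)
qed

lemma cell_in_constituents:
  assumes "w \<in> (\<Union>i\<in>I. conditioning (F i))"
  shows "cell (generating_events F I) w \<in> constituents F I"
proof -
  obtain i where i: "i \<in> I" "w \<in> conditioning (F i)" using assms by blast
  then have "cell (generating_events F I) w \<subseteq> conditioning (F i)"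
    using conditioning_generating[OF i(1), of F] unfolding cell_def by blast
  then have "cell (generating_events F I) w \<subseteq> (\<Union>i\<in>I. conditioning (F i))"
    using i(1) by blast
  then show ?thesis
    by (simp add: constituents_def cell_in_atoms)
qed

section \<open>Necessary conditions for coherence\<close>

lemma solutions_affine_nonneg:
  assumes L: "L \<in> solutions F \<mu> I"
    and nonneg: "\<And>w. w \<in> (\<Union>i\<in>I. conditioning (F i)) \<Longrightarrow>
       d + (\<Sum>i\<in>I. c i * value_at F \<mu> i w) \<ge> 0"
  shows "d + (\<Sum>i\<in>I. c i * \<mu> i) \<ge> 0"
proof -
  let ?C = "constituents F I"
  have one: "sum L ?C = 1" and ge: "\<And>C. C \<in> ?C \<Longrightarrow> L C \<ge> 0"
    and eq: "\<And>i. i \<in> I \<Longrightarrow> (\<Sum>C\<in>?C. L C * point F \<mu> C i) = \<mu> i"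
    using L unfolding solutions_def by blast+
  have "0 \<le> (\<Sum>C\<in>?C. L C * (d + (\<Sum>i\<in>I. c i * point F \<mu> C i)))"
  proof (intro sum_nonneg mult_nonneg_nonneg)
    fix C assume C: "C \<in> ?C"
    then obtain w where w: "w \<in> C" using constituent_nonempty by blast
    then have "w \<in> (\<Union>i\<in>I. conditioning (F i))"
      using C by (auto simp: constituents_def)
    from nonneg[OF this] show "0 \<le> d + (\<Sum>i\<in>I. c i * point F \<mu> C i)"
      by (simp add: point_eq_value_at[OF C _ w])
  qed (use ge in auto)
  also have "\<dots> = d * sum L ?C + (\<Sum>C\<in>?C. \<Sum>i\<in>I. c i * (L C * point F \<mu> C i))"
    by (simp add: algebra_simps sum.distrib sum_distrib_left)
  also have "(\<Sum>C\<in>?C. \<Sum>i\<in>I. c i * (L C * point F \<mu> C i))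
      = (\<Sum>i\<in>I. c i * (\<Sum>C\<in>?C. L C * point F \<mu> C i))"
    by (subst sum.swap) (simp add: sum_distrib_left)
  also have "\<dots> = (\<Sum>i\<in>I. c i * \<mu> i)"
    using eq by simp
  finally show ?thesis using one by simp
qed

lemma coherent_on_solutions: "coherent_on F \<mu> I \<Longrightarrow> solutions F \<mu> I \<noteq> {}"
  by (cases rule: coherent_on.cases) auto

text \<open>One system alone cannot force the bounds: if no solution charges the conditioning event,
  equation \<open>i\<close> only says \<open>\<mu> i = \<mu> i\<close>. In that case
  \<open>i\<close> is a null index and the recursive call supplies the bounds; otherwise
  \<open>\<mu> i\<close> is a weighted average of values taken on the event.\<close>

lemma coherent_on_bounds:
  assumes "coherent_on F \<mu> I" "i \<in> I"
    and bounds: "\<And>w. w \<in> conditioning (F i) \<Longrightarrow> a \<le> quantity (F i) w \<and> quantity (F i) w \<le> b"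
  shows "a \<le> \<mu> i \<and> \<mu> i \<le> b"
  using assms(1,2)
proof (induction rule: coherent_on.induct)
  case (1 I)
  let ?C = "constituents F I" and ?D = "{C. C \<in> constituents F I \<and> C \<subseteq> conditioning (F i)}"
  show ?case
  proof (cases "i \<in> null_indices F \<mu> I")
    case True
    then show ?thesis using "1.IH" by blast
  next
    case False
    have "\<exists>L\<in>solutions F \<mu> I. sum L ?D \<noteq> 0"
    proof (rule ccontr)
      assume "\<not> ?thesis"
      then have "(SUP L\<in>solutions F \<mu> I. sum L ?D) = 0"
        using 1(1) by simp
      with False \<open>i \<in> I\<close> show False by (simp add: null_indices_def)
    qed
    then obtain L where L: "L \<in> solutions F \<mu> I" and "sum L ?D \<noteq> 0" by blast
    have one: "sum L ?C = 1" and ge: "\<And>C. C \<in> ?C \<Longrightarrow> L C \<ge> 0"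
      and eq: "(\<Sum>C\<in>?C. L C * point F \<mu> C i) = \<mu> i"
      using L \<open>i \<in> I\<close> unfolding solutions_def by blast+
    have fin: "finite ?C" using one by (metis sum.infinite zero_neq_one)
    have "sum L ?D \<ge> 0" using ge by (auto intro: sum_nonneg)
    with \<open>sum L ?D \<noteq> 0\<close> have pos: "sum L ?D > 0" by simp
    \<comment> \<open>Constituents outside the conditioning event drop out, because
      \<open>point\<close> equals \<open>\<mu> i\<close> there.\<close>
    have "(\<Sum>C\<in>?D. L C * (point F \<mu> C i - \<mu> i)) = (\<Sum>C\<in>?C. L C * (point F \<mu> C i - \<mu> i))"
      by (rule sum.mono_neutral_left) (use fin in \<open>auto simp: point_def\<close>)
    also have "\<dots> = \<mu> i - (\<Sum>C\<in>?C. L C) * \<mu> i"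
      by (simp add: right_diff_distrib sum_subtractf eq sum_distrib_right)
    finally have zero: "(\<Sum>C\<in>?D. L C * (point F \<mu> C i - \<mu> i)) = 0"
      using one by simp
    have pt: "a \<le> point F \<mu> C i \<and> point F \<mu> C i \<le> b" if C: "C \<in> ?D" for C
    proof -
      obtain w where w: "w \<in> C" using C constituent_nonempty by blast
      then show ?thesis
        using C bounds[of w] point_eq_value_at[OF _ \<open>i \<in> I\<close> w, of F \<mu>]
        by (auto simp: value_at_def)
    qed
    have "(\<Sum>C\<in>?D. L C) * (a - \<mu> i) \<le> 0"
      unfolding zero[symmetric] sum_distrib_right
      by (intro sum_mono mult_left_mono) (use pt ge in auto)
    moreover have "0 \<le> (\<Sum>C\<in>?D. L C) * (b - \<mu> i)"
      unfolding zero[symmetric] sum_distrib_right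
      by (intro sum_mono mult_left_mono) (use pt ge in auto)
    ultimately show ?thesis
      using pos by (simp add: mult_le_0_iff zero_le_mult_iff)
  qed
qed

section \<open>A sufficient criterion for coherence\<close>

text \<open>The weight \<open>p\<close> is pushed forward to constituents by sending each outcome to
  its cell, which gives a solution. Since it charges every conditioning event, all suprema are
  positive and there are no null indices.\<close>

lemma coherent_onI:
  fixes \<omega> :: "'j \<Rightarrow> 'w" and p :: "'j \<Rightarrow> real"
  assumes I: "finite I" "\<And>i. i \<in> I \<Longrightarrow> finite (quantity (F i) ` conditioning (F i))"
    and J: "finite J" "\<And>j. j \<in> J \<Longrightarrow> \<omega> j \<in> (\<Union>i\<in>I. conditioning (F i))"
    and p: "\<And>j. j \<in> J \<Longrightarrow> p j \<ge> 0" "sum p J = 1"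
    and eq: "\<And>i. i \<in> I \<Longrightarrow> (\<Sum>j\<in>J. p j * value_at F \<mu> i (\<omega> j)) = \<mu> i"
    and pos: "\<And>i. i \<in> I \<Longrightarrow> \<exists>j\<in>J. \<omega> j \<in> conditioning (F i) \<and> p j > 0"
  shows "coherent_on F \<mu> I"
proof -
  let ?C = "constituents F I"
  define g where "g j = cell (generating_events F I) (\<omega> j)" for j
  define L where "L C = (\<Sum>j\<in>{j\<in>J. g j = C}. p j)" for C
  have fin: "finite ?C" using I by (rule finite_constituents)
  have gC: "g j \<in> ?C" if "j \<in> J" for j
    using cell_in_constituents[OF J(2)[OF that]] by (simp add: g_def)
  have mem: "\<omega> j \<in> g j" for j
    by (simp add: g_def cell_def)
  have push: "(\<Sum>C\<in>?C. L C * f C) = (\<Sum>j\<in>J. p j * f (g j))" for f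
  proof -
    have "(\<Sum>C\<in>?C. L C * f C) = (\<Sum>C\<in>?C. \<Sum>j\<in>{j\<in>J. g j = C}. p j * f (g j))"
      unfolding L_def sum_distrib_right by (intro sum.cong) auto
    also have "\<dots> = (\<Sum>j\<in>J. p j * f (g j))"
      by (rule sum.group) (use J fin gC in auto)
    finally show ?thesis .
  qed
  have Lnn: "L C \<ge> 0" for C
    unfolding L_def using p by (auto intro: sum_nonneg)
  have sol: "L \<in> solutions F \<mu> I"
    unfolding solutions_def
  proof (intro CollectI conjI ballI)
    show "sum L ?C = 1" using push[of "\<lambda>_. 1"] p by simp
    fix i assume i: "i \<in> I"
    have "(\<Sum>C\<in>?C. L C * point F \<mu> C i) = (\<Sum>j\<in>J. p j * value_at F \<mu> i (\<omega> j))"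
      unfolding push by (intro sum.cong refl) (simp add: point_eq_value_at[OF gC i mem])
    then show "(\<Sum>C\<in>?C. L C * point F \<mu> C i) = \<mu> i"
      using eq[OF i] by simp
  qed (rule Lnn)
  have "null_indices F \<mu> I = {}"
  proof (rule ccontr)
    assume "null_indices F \<mu> I \<noteq> {}"
    then obtain i where i: "i \<in> I" and
      sup: "(SUP \<Lambda>\<in>solutions F \<mu> I. \<Sum>C | C \<in> ?C \<and> C \<subseteq> conditioning (F i). \<Lambda> C) = 0"
      by (auto simp: null_indices_def)
    let ?D = "{C. C \<in> ?C \<and> C \<subseteq> conditioning (F i)}"
    obtain j where j: "j \<in> J" "\<omega> j \<in> conditioning (F i)" "p j > 0"
      using pos[OF i] by blast
    have gD: "g j \<in> ?D"
      using gC[OF j(1)] constituent_subset_conditioning[OF gC[OF j(1)] i mem] j by auto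
    have "p j \<le> L (g j)"
      unfolding L_def by (rule member_le_sum) (use j J p in auto)
    also have "\<dots> \<le> sum L ?D"
      by (rule member_le_sum) (use gD fin Lnn in auto)
    \<comment> \<open>A real supremum dominates its members only for a bounded family; the total
      mass 1 is a bound.\<close>
    also have "\<dots> \<le> (SUP M\<in>solutions F \<mu> I. sum M ?D)"
    proof (rule cSUP_upper[OF sol], rule bdd_aboveI2)
      fix M assume M: "M \<in> solutions F \<mu> I"
      have "sum M ?D \<le> sum M ?C"
        by (rule sum_mono2) (use fin M in \<open>auto simp: solutions_def\<close>)
      then show "sum M ?D \<le> 1"
        using M by (simp add: solutions_def)
    qed
    finally show False using sup j by simp
  qed
  then show ?thesis
    using sol by (intro coherent_on.intros) auto
qed

section \<open>Explicit weights on the six constituents\<close>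

text \<open>The weights \<open>l1, \<dots>, l6\<close> belong, in this order, to \<open>AHK\<close>, \<open>AH\<not>K\<close>, \<open>A\<not>HK\<close>, \<open>\<not>AHK\<close>,
  \<open>\<not>AH\<not>K\<close>, \<open>\<not>A\<not>HK\<close>.\<close>

definition conj_weights ::
  "real \<Rightarrow> real \<Rightarrow> real \<Rightarrow> real \<Rightarrow> real \<Rightarrow> real \<Rightarrow> real \<Rightarrow> real \<Rightarrow> real \<Rightarrow> bool" where
  "conj_weights x y z l1 l2 l3 l4 l5 l6 \<longleftrightarrow>
     l1 \<ge> 0 \<and> l2 \<ge> 0 \<and> l3 \<ge> 0 \<and> l4 \<ge> 0 \<and> l5 \<ge> 0 \<and> l6 \<ge> 0 \<and>
     l1 + l2 + l3 + l4 + l5 + l6 = 1 \<and>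
     l1 + l2 + x * l3 + x * l6 = x \<and>
     l1 + y * l2 + l3 + y * l5 = y \<and>
     l1 + y * l2 + x * l3 = z \<and>
     l1 + l2 + l4 + l5 > 0 \<and> l1 + l3 + l4 + l6 > 0"

text \<open>Exchanging \<open>H\<close> and \<open>K\<close> fixes \<open>AHK\<close> and
  \<open>\<not>AHK\<close> and swaps the other constituents in pairs.\<close>

lemma conj_weights_swap:
  "conj_weights x y z l1 l2 l3 l4 l5 l6 \<Longrightarrow> conj_weights y x z l1 l3 l2 l4 l6 l5"
  by (auto simp: conj_weights_def algebra_simps)

lemma conj_weights_exist_le:
  assumes x: "0 \<le> x" and xy: "x \<le> y" and y: "y \<le> 1" and z: "x * y \<le> z" "z \<le> x"
  shows "\<exists>l1 l2 l3 l4 l5 l6. conj_weights x y z l1 l2 l3 l4 l5 l6"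
proof (cases "z = x * y")
  case True
  \<comment> \<open>\<open>H \<inter> -K\<close> and \<open>-H \<inter> K\<close> get mass 1/2 each,
    split by \<open>A\<close> in the ratios \<open>x : 1 - x\<close> and \<open>y : 1 - y\<close>.
    The conjunction then has expectation \<open>x * y / 2 + y * x / 2\<close>.\<close>
  then have "conj_weights x y z 0 (x/2) (y/2) 0 ((1-x)/2) ((1-y)/2)"
    using assms by (auto simp: conj_weights_def field_simps)
  then show ?thesis by blast
next
  case False
  then have "x * y < x" using z by linarith
  then have x0: "x > 0" and y1: "y < 1"
    using x xy y by (auto simp: order_less_le)
  then have y0: "y > 0" using xy by simp
  \<comment> \<open>The position of \<open>z\<close> between \<open>x * y\<close> (at
    \<open>t = 0\<close>) and \<open>x\<close> (at \<open>t = 1\<close>).\<close>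
  define t where "t = (z - x * y) / (x * (1 - y))"
  have t: "0 < t" "t \<le> 1" and zt: "z = x * y + t * (x * (1 - y))"
    unfolding t_def using x0 y1 z False by (auto simp: field_simps)
  \<comment> \<open>For \<open>z = x\<close>, put masses \<open>x\<close>, \<open>r - x\<close>,
    \<open>1 - r\<close> on \<open>AHK\<close>, \<open>\<not>AHK\<close>,
    \<open>\<not>AH\<not>K\<close>. Then \<open>r\<close> is the mass of \<open>K\<close>, and
    \<open>x / r = y\<close> forces its value. The weight below is \<open>1 - t\<close> times the
    solution for \<open>x * y\<close> plus \<open>t\<close> times this one.\<close>
  define r where "r = x / y"
  have r: "0 < r" "r \<le> 1" and xr: "x = r * y"
    unfolding r_def using x0 y0 xy by auto
  have rx: "x \<le> r" unfolding xr using r y by (simp add: mult_left_le)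
  have "conj_weights x y z (t * x) ((1-t) * x/2) ((1-t) * y/2) (t * (r - x))
      ((1-t) * (1-x)/2 + t * (1 - r)) ((1-t) * (1-y)/2)"
    unfolding conj_weights_def
  proof (intro conjI)
    have nn: "0 \<le> (1-t) * (1-x)/2" "0 \<le> t * (1 - r)" "0 \<le> (1-t) * x/2" "0 \<le> (1-t) * y/2"
      "0 \<le> (1-t) * (1-y)/2" "0 \<le> t * (r - x)" "0 < t * x"
      using t r rx x0 y0 xy y by auto
    then show "0 \<le> t * x" "0 \<le> (1-t) * x/2" "0 \<le> (1-t) * y/2" "0 \<le> t * (r - x)"
      "0 \<le> (1-t) * (1-x)/2 + t * (1 - r)" "0 \<le> (1-t) * (1-y)/2"
      "0 < t * x + (1-t) * x/2 + t * (r - x) + ((1-t) * (1-x)/2 + t * (1 - r))"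
      "0 < t * x + (1-t) * y/2 + t * (r - x) + (1-t) * (1-y)/2"
      by linarith+
  \<comment> \<open>What remains are the four equations, polynomial identities in \<open>t\<close>,
    \<open>r\<close>, \<open>y\<close> once \<open>z\<close> and \<open>x\<close> are
    eliminated.\<close>
  qed (unfold zt xr, simp_all add: field_simps)
  then show ?thesis by blast
qed

lemma conj_weights_exist:
  assumes "0 \<le> x" "x \<le> 1" "0 \<le> y" "y \<le> 1" "x * y \<le> z" "z \<le> x" "z \<le> y"
  shows "\<exists>l1 l2 l3 l4 l5 l6. conj_weights x y z l1 l2 l3 l4 l5 l6"
proof (cases "x \<le> y")
  case True
  then show ?thesis using conj_weights_exist_le assms by blast
next
  case False
  then have "\<exists>l1 l2 l3 l4 l5 l6. conj_weights y x z l1 l2 l3 l4 l5 l6"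
    using assms by (intro conj_weights_exist_le) (auto simp: mult.commute)
  then show ?thesis using conj_weights_swap by blast
qed

section \<open>The three quantities of the theorem\<close>

lemma logically_independent_witness:
  assumes "logically_independent [A, H, K]"
  shows "\<exists>w. (w \<in> A \<longleftrightarrow> a) \<and> (w \<in> H \<longleftrightarrow> h) \<and> (w \<in> K \<longleftrightarrow> k)"
proof -
  let ?J = "{i\<in>{..<3::nat}. [a, h, k] ! i}"
  have "?J \<subseteq> {..<length [A, H, K]}" by auto
  then obtain w where w: "w \<in> (\<Inter>i\<in>?J. [A, H, K] ! i) \<inter>
      (\<Inter>i\<in>{..<length [A, H, K]} - ?J. - ([A, H, K] ! i))"
    using assms unfolding logically_independent_def by blast
  have "w \<in> [A, H, K] ! i \<longleftrightarrow> [a, h, k] ! i" if "i < 3" for i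
    using w that by auto
  from this[of 0] this[of 1] this[of 2] show ?thesis
    by (auto simp: numeral_2_eq_2)
qed

theorem theorem5:
  fixes A H K :: "'w set"
  assumes "logically_independent [A, H, K]"
    and "H \<noteq> {}" and "K \<noteq> {}"
  shows "{(x, y, z).
            coherent_assessment
              [cond_event A H x, cond_event A K y, conj_cond_event A H K x y z] [x, y, z]} =
         {(x, y, z). (x, y) \<in> {0..1} \<times> {0..1} \<and> x * y \<le> z \<and> z \<le> min x y}"
proof -
  have "coherent_assessment
          [cond_event A H x, cond_event A K y, conj_cond_event A H K x y z] [x, y, z]
        \<longleftrightarrow> (x, y) \<in> {0..1} \<times> {0..1} \<and> x * y \<le> z \<and> z \<le> min x y" for x y z
  proof -
    let ?F = "(!) [cond_event A H x, cond_event A K y, conj_cond_event A H K x y z]"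
    let ?\<mu> = "(!) [x, y, z]"
    let ?I = "{0, 1, 2::nat}"
    have I: "{..<3} = ?I" by auto
    have F: "?F 0 = cond_event A H x" "?F 1 = cond_event A K y"
      "?F 2 = conj_cond_event A H K x y z"
      by simp_all
    have \<mu>: "?\<mu> 0 = x" "?\<mu> 1 = y" "?\<mu> 2 = z"
      by simp_all
    have ca: "coherent_assessment
          [cond_event A H x, cond_event A K y, conj_cond_event A H K x y z] [x, y, z]
        \<longleftrightarrow> coherent_on ?F ?\<mu> ?I"
      using I by (simp add: coherent_assessment_def numeral_3_eq_3)
    have val: "value_at ?F ?\<mu> 0 w = (if w \<in> H then if w \<in> A then 1 else 0 else x)"
      "value_at ?F ?\<mu> 1 w = (if w \<in> K then if w \<in> A then 1 else 0 else y)"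
      "value_at ?F ?\<mu> 2 w =
        (if w \<in> H then if w \<in> A then if w \<in> K then 1 else y else 0
         else if w \<in> K then if w \<in> A then x else 0 else z)" for w
      unfolding value_at_def F \<mu> by (auto simp: cond_event_def conj_cond_event_def)
    have cnd: "conditioning (?F 0) = H" "conditioning (?F 1) = K" "conditioning (?F 2) = H \<union> K"
      unfolding F by (simp_all add: cond_event_def conj_cond_event_def)
    have UN: "(\<Union>i\<in>?I. conditioning (?F i)) = H \<union> K"
      using cnd by auto
    show ?thesis
      unfolding ca
    proof
      assume coh: "coherent_on ?F ?\<mu> ?I"
      have x: "0 \<le> x \<and> x \<le> 1"
        using coherent_on_bounds[OF coh, of 0 0 1] by (auto simp: cond_event_def)
      have y: "0 \<le> y \<and> y \<le> 1"
        using coherent_on_bounds[OF coh, of 1 0 1] by (auto simp: cond_event_def)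
      obtain L where L: "L \<in> solutions ?F ?\<mu> ?I"
        using coherent_on_solutions[OF coh] by blast
      have affine: "d + (c0 * x + c1 * y + c2 * z) \<ge> 0"
        if "\<And>w. w \<in> H \<union> K \<Longrightarrow> d + (c0 * value_at ?F ?\<mu> 0 w + c1 * value_at ?F ?\<mu> 1 w
            + c2 * value_at ?F ?\<mu> 2 w) \<ge> 0" for c0 c1 c2 d
      proof -
        have sum3: "(\<Sum>i\<in>?I. [c0, c1, c2] ! i * f i) = c0 * f 0 + c1 * f 1 + c2 * f 2"
          for f :: "nat \<Rightarrow> real" by simp
        from solutions_affine_nonneg[OF L, of d "(!) [c0, c1, c2]"]
        show ?thesis unfolding sum3 UN \<mu> using that by blast
      qed
      \<comment> \<open>On \<open>H \<union> K\<close> the first quantity minus the third is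
        \<open>1 - y\<close> on \<open>AH\<not>K\<close>, \<open>x\<close> on
        \<open>\<not>A\<not>HK\<close>, and 0 elsewhere. The next inequality is symmetric.\<close>
      have "0 \<le> 0 + (1 * x + 0 * y + (- 1) * z)"
        by (rule affine, unfold val) (use x y in auto)
      moreover have "0 \<le> 0 + (0 * x + 1 * y + (- 1) * z)"
        by (rule affine, unfold val) (use x y in auto)
      \<comment> \<open>At the assessment itself this expression collapses to
        \<open>z - x * y\<close>.\<close>
      moreover have "0 \<le> x * y + ((- y) * x + (- x) * y + 1 * z)"
      proof (rule affine)
        have "0 \<le> (1 - x) * (1 - y)" "0 \<le> x * y" using x y by auto
        then show "0 \<le> x * y + ((- y) * value_at ?F ?\<mu> 0 w + (- x) * value_at ?F ?\<mu> 1 w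
            + 1 * value_at ?F ?\<mu> 2 w)" if "w \<in> H \<union> K" for w
          unfolding val using that by (auto simp: algebra_simps)
      qed
      ultimately show "(x, y) \<in> {0..1} \<times> {0..1} \<and> x * y \<le> z \<and> z \<le> min x y"
        using x y by (auto simp: algebra_simps)
    next
      assume "(x, y) \<in> {0..1} \<times> {0..1} \<and> x * y \<le> z \<and> z \<le> min x y"
      then obtain l1 l2 l3 l4 l5 l6 where l: "conj_weights x y z l1 l2 l3 l4 l5 l6"
        using conj_weights_exist[of x y z] by auto
      obtain w :: "bool \<Rightarrow> bool \<Rightarrow> bool \<Rightarrow> 'w" where
        w: "\<And>a h k. w a h k \<in> A \<longleftrightarrow> a" "\<And>a h k. w a h k \<in> H \<longleftrightarrow> h" "\<And>a h k. w a h k \<in> K \<longleftrightarrow> k"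
        using logically_independent_witness[OF assms(1)] by metis
      \<comment> \<open>The arguments of \<open>w\<close> are the truth values of \<open>A\<close>,
        \<open>H\<close>, \<open>K\<close>; the order matches the weights \<open>l1\<close> to
        \<open>l6\<close>.\<close>
      define \<omega> where "\<omega> = (!) [w True True True, w True True False, w True False True,
        w False True True, w False True False, w False False True]"
      define p where "p = (!) [l1, l2, l3, l4, l5, l6]"
      let ?J = "{0, 1, 2, 3, 4, 5::nat}"
      have \<omega>: "\<omega> 0 = w True True True" "\<omega> 1 = w True True False" "\<omega> 2 = w True False True"
        "\<omega> 3 = w False True True" "\<omega> 4 = w False True False" "\<omega> 5 = w False False True"
        by (simp_all add: \<omega>_def)
      have p: "p 0 = l1" "p 1 = l2" "p 2 = l3" "p 3 = l4" "p 4 = l5" "p 5 = l6"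
        by (simp_all add: p_def)
      have sumJ: "sum f ?J = f 0 + f 1 + f 2 + f 3 + f 4 + f 5" for f :: "nat \<Rightarrow> real"
        by simp
      show "coherent_on ?F ?\<mu> ?I"
      proof (rule coherent_onI[where J = ?J and \<omega> = \<omega> and p = p])
        show "finite (quantity (?F i) ` conditioning (?F i))" if "i \<in> ?I" for i
        proof -
          have "quantity (?F i) ` conditioning (?F i) \<subseteq> {0, 1, x, y, z}"
            using that by (auto simp: cond_event_def conj_cond_event_def)
          then show ?thesis by (rule finite_subset) simp
        qed
        show "\<omega> j \<in> (\<Union>i\<in>?I. conditioning (?F i))" if "j \<in> ?J" for j
          unfolding UN using that \<omega> w by auto
        show "p j \<ge> 0" if "j \<in> ?J" for j
          using that p l by (auto simp: conj_weights_def)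
        show "sum p ?J = 1"
          unfolding sumJ p using l by (simp add: conj_weights_def)
        show "(\<Sum>j\<in>?J. p j * value_at ?F ?\<mu> i (\<omega> j)) = ?\<mu> i" if "i \<in> ?I" for i
        proof -
          consider "i = 0" | "i = 1" | "i = 2" using \<open>i \<in> ?I\<close> by blast
          then show ?thesis
            by cases (use l in \<open>simp_all only: sumJ p \<omega> val \<mu> w if_True if_False,
              simp_all add: conj_weights_def algebra_simps\<close>)
        qed
        show "\<exists>j\<in>?J. \<omega> j \<in> conditioning (?F i) \<and> p j > 0" if "i \<in> ?I" for i
        proof -
          \<comment> \<open>A positive sum has a positive term. The first disjunction serves
            \<open>H\<close>, the second \<open>K\<close>, and either one serves
            \<open>H \<union> K\<close>.\<close>
          have hk: "l1 > 0 \<or> l2 > 0 \<or> l4 > 0 \<or> l5 > 0" "l1 > 0 \<or> l3 > 0 \<or> l4 > 0 \<or> l6 > 0"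
            using l unfolding conj_weights_def by linarith+
          consider "i = 0" | "i = 1" | "i = 2" using \<open>i \<in> ?I\<close> by blast
          then show ?thesis
            by cases (use hk in \<open>simp_all only: cnd Un_iff bex_simps p \<omega> w, blast+\<close>)
        qed
      qed auto
    qed
  qed
  then show ?thesis by auto
qed

end
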